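(* Let $T$ be a finite tree with $n$ vertices and let $\chi_T(x)=\det(x\,\mathrm{Id}_n-A)\in\mathbb Z[x]$ be the characteristic polynomial of its adjacency matrix $A$. Then for every prime power $q$, the number of invertible Schr\"odinger operators of $T$ over the finite field $\mathbb F_q$ equals $$\left(-\sqrt{-q}\right)^n\chi_T\!\left(\sqrt{-q}+1/\sqrt{-q}\right).$$
   Context: All graphs are finite, with unoriented edges, no loops and no multiple edges. A Schr\"odinger operator of a graph $G$ with vertex set $V$ over a field $\mathbb F$ is a matrix of the form $A+D$, where $A$ is the adjacency matrix of $G$ (rows and columns indexed by $V$) and $D$ is an arbitrary diagonal matrix with entries in $\mathbb F$. The number of invertible Schr\"odinger operators over $\mathbb F_q$ is thus the number of diagonal matrices $D$ over $\mathbb F_q$ such that $A+D$ is invertible. *)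

theory Defs
  imports "HOL-Analysis.Analysis" "HOL-Computational_Algebra.Polynomial"
begin

text \<open>
  The vertex set of a graph is the whole of a (finite, hence nonempty) type \<open>'v\<close>; an unoriented
  edge between \<open>u\<close> and \<open>v\<close> is represented by the two pairs \<open>(u, v)\<close> and \<open>(v, u)\<close>.
\<close>

definition simple_graph :: "'v rel \<Rightarrow> bool" where
  "simple_graph E \<longleftrightarrow> sym E \<and> irrefl E"

definition connected_graph :: "'v rel \<Rightarrow> bool" where
  "connected_graph E \<longleftrightarrow> (\<forall>u v. (u, v) \<in> E\<^sup>*)"

text \<open>
  The bound \<open>3 \<le> length c\<close> prevents going back and forth along one edge from counting as a cycle.
\<close>

definition graph_cycle :: "'v rel \<Rightarrow> 'v list \<Rightarrow> bool" where
  "graph_cycle E c \<longleftrightarrow> 3 \<le> length c \<and> distinct c \<and>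
     (\<forall>i < length c. (c ! i, c ! (Suc i mod length c)) \<in> E)"

definition tree_graph :: "'v rel \<Rightarrow> bool" where
  "tree_graph E \<longleftrightarrow> simple_graph E \<and> connected_graph E \<and> (\<nexists>c. graph_cycle E c)"

definition adjacency_matrix :: "('v::finite) rel \<Rightarrow> ('a::zero_neq_one) ^ 'v ^ 'v" where
  "adjacency_matrix E = (\<chi> i j. if (i, j) \<in> E then 1 else 0)"

definition diagonal_matrix :: "('a::zero) ^ 'v ^ 'v \<Rightarrow> bool" where
  "diagonal_matrix D \<longleftrightarrow> (\<forall>i j. i \<noteq> j \<longrightarrow> D $ i $ j = 0)"

definition schroedinger_operator :: "('v::finite) rel \<Rightarrow> ('a::field) ^ 'v ^ 'v \<Rightarrow> bool" where
  "schroedinger_operator E M \<longleftrightarrow> (\<exists>D. diagonal_matrix D \<and> M = adjacency_matrix E + D)"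

definition charpoly :: "('a::comm_ring_1) ^ 'v ^ 'v \<Rightarrow> 'a poly" where
  "charpoly A = det (mat [:0, 1:] - map_matrix (\<lambda>a. [:a:]) A)"

definition graph_charpoly :: "('v::finite) rel \<Rightarrow> int poly" where
  "graph_charpoly E = charpoly (adjacency_matrix E)"

end

theory Submission
  imports Defs
begin

text \<open>
  Only acyclicity of \<open>T\<close> matters, so one may induct over the induced subgraphs on vertex sets \<open>S\<close>.
  Let \<open>v\<close> be a leaf of \<open>S\<close> with neighbour \<open>u\<close>, and let \<open>M\<^sub>S\<close> be a Schroedinger operator of \<open>S\<close> with
  diagonal \<open>d\<close>. Then \<open>det M\<^sub>S = d\<^sub>v a - b\<close> where \<open>a\<close> and \<open>b\<close> are the determinants for \<open>S - {v}\<close> and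
  \<open>S - {u, v}\<close>. If \<open>a \<noteq> 0\<close>, then \<open>q - 1\<close> values of \<open>d\<^sub>v\<close> make this nonzero; if \<open>a = 0 \<noteq> b\<close>, all \<open>q\<close>
  values do; otherwise none. As \<open>a\<close> is affine in \<open>d\<^sub>u\<close> with slope \<open>b\<close>, each choice of diagonal on
  \<open>S - {u, v}\<close> with \<open>b \<noteq> 0\<close> admits exactly one \<open>d\<^sub>u\<close> with \<open>a = 0\<close>. Hence the numbers of invertible
  operators satisfy \<open>N(S) = (q - 1) N(S - {v}) + q N(S - {u, v})\<close>. This is the recursion
  \<open>\<chi>\<^sub>S(x) = x \<chi>\<^bsub>S - {v}\<^esub>(x) - \<chi>\<^bsub>S - {u, v}\<^esub>(x)\<close> at \<open>x = s + 1/s\<close>, \<open>s\<^sup>2 = -q\<close>, rescaled by \<open>(-s)\<^bsup>|S|\<^esup>\<close>.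
\<close>

section \<open>Determinants\<close>

text \<open>Its determinant is the principal minor without row and column \<open>v\<close>; filling
  with the identity keeps the index type, so deletions can be iterated.\<close>

definition cut_index :: "'n \<Rightarrow> 'a::zero_neq_one ^ 'n ^ 'n \<Rightarrow> 'a ^ 'n ^ 'n" where
  "cut_index v A = (\<chi> i j. if i = v \<or> j = v then (if i = j then 1 else 0) else A $ i $ j)"

lemma cut_index_nth [simp]:
  "cut_index v A $ i $ j = (if i = v \<or> j = v then (if i = j then 1 else 0) else A $ i $ j)"
  by (simp add: cut_index_def)

text \<open>In the Leibniz formula both sides get nothing from permutations that move
  \<open>v\<close>; the others use no further entry of row or column \<open>v\<close>.\<close>

lemma det_single_entry_row:
  fixes A :: "'a::comm_ring_1 ^ 'n::finite ^ 'n"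
  assumes "\<And>j. j \<noteq> v \<Longrightarrow> A $ v $ j = 0"
  shows "det A = A $ v $ v * det (cut_index v A)"
  unfolding det_def sum_distrib_left
proof (rule sum.cong[OF refl])
  fix p :: "'n \<Rightarrow> 'n"
  assume "p \<in> {p. p permutes UNIV}"
  then have inj: "inj p"
    by (simp add: permutes_inj)
  have split: "(\<Prod>i\<in>UNIV. B $ i $ p i) = B $ v $ p v * (\<Prod>i\<in>UNIV - {v}. B $ i $ p i)"
    for B :: "'a ^ 'n ^ 'n"
    by (simp add: prod.remove)
  show "of_int (sign p) * (\<Prod>i\<in>UNIV. A $ i $ p i) =
    A $ v $ v * (of_int (sign p) * (\<Prod>i\<in>UNIV. cut_index v A $ i $ p i))"
  proof (cases "p v = v")
    case True
    have "p i \<noteq> v" if "i \<noteq> v" for i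
      using inj True that by (metis injD)
    then have "(\<Prod>i\<in>UNIV - {v}. cut_index v A $ i $ p i) = (\<Prod>i\<in>UNIV - {v}. A $ i $ p i)"
      by (intro prod.cong) auto
    with True show ?thesis
      unfolding split by simp
  next
    case False
    then show ?thesis
      unfolding split using assms by auto
  qed
qed

lemma det_single_entry_column:
  fixes A :: "'a::comm_ring_1 ^ 'n::finite ^ 'n"
  assumes "\<And>i. i \<noteq> v \<Longrightarrow> A $ i $ v = 0"
  shows "det A = A $ v $ v * det (cut_index v A)"
proof -
  have "cut_index v (transpose A) = transpose (cut_index v A)"
    by (auto simp: vec_eq_iff transpose_def)
  then show ?thesis
    using det_single_entry_row[of v "transpose A"] assms
    by (simp add: transpose_def[of A] det_transpose[of A, unfolded transpose_def])
qed

text \<open>Linearity in row \<open>v\<close>, split into its diagonal entry and the rest, isolates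
  \<open>A $ v $ v\<close>: neither determinant on the right depends on it.\<close>

lemma det_affine_diagonal_entry:
  fixes A :: "'a::comm_ring_1 ^ 'n::finite ^ 'n"
  shows "det A = A $ v $ v * det (cut_index v A) +
    det (\<chi> i j. if i = v \<and> j = v then 0 else A $ i $ j)"
proof -
  let ?r = "\<chi> j. if j = v then 0 else A $ v $ j"
  let ?e = "A $ v $ v *s axis v 1"
  let ?D = "(\<chi> i. if i = v then ?e else A $ i) :: 'a ^ 'n ^ 'n"
  have "det A = det (\<chi> i. if i = v then ?e + ?r else A $ i)"
    by (intro arg_cong[where f = det]) (auto simp: vec_eq_iff axis_def)
  also have "\<dots> = det ?D + det (\<chi> i. if i = v then ?r else A $ i)"
    by (rule det_row_add)
  also have "det ?D = ?D $ v $ v * det (cut_index v ?D)"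
    by (rule det_single_entry_row) (auto simp: axis_def)
  also have "cut_index v ?D = cut_index v A"
    by (auto simp: vec_eq_iff)
  also have "?D $ v $ v = A $ v $ v"
    by (simp add: axis_def)
  also have "(\<chi> i. if i = v then ?r else A $ i) = (\<chi> i j. if i = v \<and> j = v then 0 else A $ i $ j)"
    by (auto simp: vec_eq_iff)
  finally show ?thesis .
qed

text \<open>Once the entry at \<open>(v, v)\<close> is cleared, exchanging rows \<open>u\<close> and
  \<open>v\<close> moves the only possibly nonzero entries of row and column \<open>v\<close> onto
  the diagonal; the swap causes the minus sign.\<close>

lemma det_leaf:
  fixes A :: "'a::comm_ring_1 ^ 'n::finite ^ 'n"
  assumes "u \<noteq> v"
    and row: "\<And>j. j \<noteq> u \<Longrightarrow> j \<noteq> v \<Longrightarrow> A $ v $ j = 0"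
    and col: "\<And>i. i \<noteq> u \<Longrightarrow> i \<noteq> v \<Longrightarrow> A $ i $ v = 0"
  shows "det A = A $ v $ v * det (cut_index v A) -
    A $ u $ v * A $ v $ u * det (cut_index u (cut_index v A))"
proof -
  let ?Z = "(\<chi> i j. if i = v \<and> j = v then 0 else A $ i $ j) :: 'a ^ 'n ^ 'n"
  let ?t = "Transposition.transpose u v"
  let ?C = "(\<chi> i. ?Z $ ?t i) :: 'a ^ 'n ^ 'n"
  have t: "?t u = v" "?t v = u" "\<And>i. i \<noteq> u \<Longrightarrow> i \<noteq> v \<Longrightarrow> ?t i = i"
    by (simp_all add: Transposition.transpose_def)
  have "det ?C = of_int (sign ?t) * det ?Z"
    by (rule det_permute_rows) (simp add: permutes_swap_id)
  then have "det ?Z = - det ?C"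
    using assms(1) by (simp add: sign_swap_id)
  also have "det ?C = ?C $ u $ u * det (cut_index u ?C)"
    by (rule det_single_entry_row) (auto simp: t row)
  also have "det (cut_index u ?C) = cut_index u ?C $ v $ v * det (cut_index v (cut_index u ?C))"
  proof (rule det_single_entry_column)
    fix i assume "i \<noteq> v"
    then show "cut_index u ?C $ i $ v = 0"
      by (cases "i = u") (auto simp: t col)
  qed
  also have "cut_index v (cut_index u ?C) = cut_index u (cut_index v A)"
    by (auto simp: vec_eq_iff t)
  finally show ?thesis
    using det_affine_diagonal_entry[of A v] assms(1) by (simp add: t)
qed

lemma det_hom:
  fixes A :: "'a::comm_ring_1 ^ 'n::finite ^ 'n" and h :: "'a \<Rightarrow> 'b::comm_ring_1"
  assumes add: "\<And>x y. h (x + y) = h x + h y"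
    and mult: "\<And>x y. h (x * y) = h x * h y"
    and one: "h 1 = 1"
  shows "h (det A) = det (map_matrix h A)"
proof -
  have zero: "h 0 = 0"
    using add[of 0 0] by simp
  have uminus: "h (- x) = - h x" for x
    using add[of x "- x"] zero by (simp add: eq_neg_iff_add_eq_0 add.commute)
  have sum: "h (sum f I) = (\<Sum>i\<in>I. h (f i))" for f and I :: "('n \<Rightarrow> 'n) set"
    by (induction I rule: infinite_finite_induct) (simp_all add: zero add)
  have prod: "h (prod f I) = (\<Prod>i\<in>I. h (f i))" for f and I :: "'n set"
    by (induction I rule: infinite_finite_induct) (simp_all add: one mult)
  have "h (of_int (sign p)) = of_int (sign p)" for p :: "'n \<Rightarrow> 'n"
    by (simp add: sign_def one uminus)
  then show ?thesis
    by (simp add: det_def sum mult prod)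
qed

lemma poly_of_int_add:
  fixes z :: "'a::comm_ring_1"
  shows "poly (map_poly of_int (p + r)) z = poly (map_poly of_int p) z + poly (map_poly of_int r) z"
proof -
  have "map_poly of_int (p + r) = (map_poly of_int p + map_poly of_int r :: 'a poly)"
    by (intro poly_eqI) (simp add: coeff_map_poly)
  then show ?thesis
    by simp
qed

lemma poly_of_int_mult:
  fixes z :: "'a::comm_ring_1"
  shows "poly (map_poly of_int (p * r)) z = poly (map_poly of_int p) z * poly (map_poly of_int r) z"
  by (induction p)
    (simp_all add: poly_of_int_add map_poly_pCons map_poly_smult algebra_simps)

text \<open>Evaluation at \<open>z\<close> is a ring homomorphism on integer polynomials, so it
  commutes with the determinant.\<close>

lemma poly_charpoly_of_int:
  fixes A :: "int ^ 'n::finite ^ 'n" and z :: "'a::comm_ring_1"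
  shows "poly (map_poly of_int (charpoly A)) z = det (mat z - map_matrix of_int A)"
proof -
  let ?h = "\<lambda>p. poly (map_poly of_int p) z"
  have "?h (charpoly A) = det (map_matrix ?h (mat [:0, 1:] - map_matrix (\<lambda>a. [:a:]) A))"
    unfolding charpoly_def
    by (rule det_hom) (simp_all add: poly_of_int_add poly_of_int_mult)
  also have "map_matrix ?h (mat [:0, 1:] - map_matrix (\<lambda>a. [:a:]) A) = mat z - map_matrix of_int A"
    by (auto simp: vec_eq_iff mat_def map_poly_pCons)
  finally show ?thesis .
qed

section \<open>Leaves of forests\<close>

text \<open>At the head of a longest path in \<open>S\<close>, a neighbour in \<open>S\<close> other
  than the second vertex would close a cycle. An isolated \<open>v\<close> is included, with
  arbitrary \<open>u\<close>.\<close>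

lemma acyclic_graph_leaf:
  fixes E :: "'v rel"
  assumes "simple_graph E" and acyclic: "\<nexists>c. graph_cycle E c"
    and "finite S" "S \<noteq> {}"
  shows "\<exists>v\<in>S. \<exists>u. \<forall>w\<in>S. (v, w) \<in> E \<longrightarrow> w = u"
proof (rule ccontr)
  assume no_leaf: "\<not> ?thesis"
  define path where "path c \<longleftrightarrow> c \<noteq> [] \<and> distinct c \<and> set c \<subseteq> S \<and>
    (\<forall>i. Suc i < length c \<longrightarrow> (c ! i, c ! Suc i) \<in> E)" for c
  obtain x where "x \<in> S"
    using assms(4) by blast
  then have "path [x]"
    by (simp add: path_def)
  moreover have "\<forall>c. path c \<longrightarrow> length c \<le> card S"
    using assms(3) by (metis path_def card_mono distinct_card)
  ultimately obtain c where c: "path c" and longest: "\<And>c'. path c' \<Longrightarrow> length c' \<le> length c"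
    using ex_has_greatest_nat[of path "[x]" length "Suc (card S)"]
    by (metis le_imp_less_Suc)
  have sym: "sym E" and irrefl: "irrefl E"
    using assms(1) by (auto simp: simple_graph_def)
  have nz: "c \<noteq> []" and hd: "hd c \<in> S"
    using c by (auto simp: path_def)
  \<comment> \<open>Otherwise the path could be prolonged at its head.\<close>
  have nbr: "w \<in> set c" if "w \<in> S" "(hd c, w) \<in> E" for w
  proof (rule ccontr)
    assume "w \<notin> set c"
    have "path (w # c)"
      unfolding path_def
    proof (intro conjI allI impI)
      fix i assume "Suc i < length (w # c)"
      then show "((w # c) ! i, (w # c) ! Suc i) \<in> E"
        using c that sym nz by (cases i) (auto simp: path_def hd_conv_nth dest: symD)
    qed (use c that \<open>w \<notin> set c\<close> in \<open>auto simp: path_def\<close>)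
    from longest[OF this] show False
      by simp
  qed
  \<comment> \<open>For a one-vertex path \<open>c ! 1\<close> is unspecified; this is harmless, as
    \<open>no_leaf\<close> excludes every choice of \<open>u\<close>.\<close>
  have "\<exists>w\<in>S. (hd c, w) \<in> E \<and> w \<noteq> c ! 1"
    using no_leaf hd by blast
  then obtain w where w: "w \<in> S" "(hd c, w) \<in> E" "w \<noteq> c ! 1"
    by blast
  then obtain k where k: "k < length c" "c ! k = w"
    using nbr by (metis in_set_conv_nth)
  have "k \<noteq> 0"
    using irrefl w k nz by (metis hd_conv_nth irreflD)
  moreover have "k \<noteq> 1"
    using w k by auto
  ultimately have k2: "2 \<le> k"
    by simp
  have len: "length (take (Suc k) c) = Suc k"
    using k by simp
  \<comment> \<open>As \<open>k\<close> is at least 2, this prefix has at least three vertices; the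
    edge from \<open>w\<close> back to the head closes it.\<close>
  have "graph_cycle E (take (Suc k) c)"
    unfolding graph_cycle_def len
  proof (intro conjI allI impI)
    fix i assume i: "i < Suc k"
    show "(take (Suc k) c ! i, take (Suc k) c ! (Suc i mod Suc k)) \<in> E"
    proof (cases "i = k")
      case True
      then show ?thesis
        using k w sym nz by (auto simp: hd_conv_nth dest: symD)
    next
      case False
      then show ?thesis
        using k i c by (auto simp: path_def)
    qed
  qed (use k k2 c in \<open>auto simp: path_def\<close>)
  then show False
    using acyclic by blast
qed

section \<open>Operators of induced subgraphs\<close>

text \<open>
  The operator of the subgraph induced on \<open>S\<close>, extended by the identity outside \<open>S\<close>, so that all
  matrices have the same type. The common edge weight \<open>c\<close> is \<open>1\<close> for Schroedinger operators and
  \<open>-1\<close> for characteristic polynomials.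
\<close>

definition subgraph_matrix :: "'v rel \<Rightarrow> 'a::zero_neq_one \<Rightarrow> 'v set \<Rightarrow> ('v \<Rightarrow> 'a) \<Rightarrow> 'a ^ 'v ^ 'v" where
  "subgraph_matrix E c S d = (\<chi> i j.
     if i = j then (if i \<in> S then d i else 1)
     else if i \<in> S \<and> j \<in> S \<and> (i, j) \<in> E then c else 0)"

lemma cut_index_subgraph_matrix:
  "cut_index v (subgraph_matrix E c S d) = subgraph_matrix E c (S - {v}) d"
  by (auto simp: vec_eq_iff subgraph_matrix_def)

lemma subgraph_matrix_empty: "subgraph_matrix E c {} d = mat 1"
  by (auto simp: vec_eq_iff subgraph_matrix_def mat_def)

lemma subgraph_matrix_cong:
  assumes "\<And>i. i \<in> S \<Longrightarrow> d i = d' i"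
  shows "subgraph_matrix E c S d = subgraph_matrix E c S d'"
  using assms by (auto simp: vec_eq_iff subgraph_matrix_def)

lemma subgraph_matrix_fun_upd:
  "v \<notin> S \<Longrightarrow> subgraph_matrix E c S (d(v := x)) = subgraph_matrix E c S d"
  by (rule subgraph_matrix_cong) auto

lemma det_subgraph_matrix_isolated:
  fixes c :: "'a::comm_ring_1" and E :: "'v::finite rel"
  assumes "v \<in> S" "\<And>w. w \<in> S \<Longrightarrow> (v, w) \<notin> E"
  shows "det (subgraph_matrix E c S d) = d v * det (subgraph_matrix E c (S - {v}) d)"
proof -
  have "det (subgraph_matrix E c S d) =
      subgraph_matrix E c S d $ v $ v * det (cut_index v (subgraph_matrix E c S d))"
    by (rule det_single_entry_row) (use assms in \<open>auto simp: subgraph_matrix_def\<close>)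
  then show ?thesis
    using assms(1) by (simp add: cut_index_subgraph_matrix) (simp add: subgraph_matrix_def)
qed

text \<open>The edge weight enters only through \<open>c * c\<close>, which is \<open>1\<close> for
  both weights in use, so one expansion serves operators and characteristic polynomials
  alike.\<close>

lemma det_subgraph_matrix_leaf:
  fixes c :: "'a::comm_ring_1" and E :: "'v::finite rel"
  assumes "sym E" "v \<in> S" "u \<in> S" "u \<noteq> v" "(v, u) \<in> E"
    and leaf: "\<And>w. w \<in> S \<Longrightarrow> (v, w) \<in> E \<Longrightarrow> w = u"
  shows "det (subgraph_matrix E c S d) =
    d v * det (subgraph_matrix E c (S - {v}) d) - c * c * det (subgraph_matrix E c (S - {v} - {u}) d)"
proof -
  let ?M = "subgraph_matrix E c S d"
  have leaf': "w = u" if "w \<in> S" "(w, v) \<in> E" for w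
    using that leaf assms(1) by (metis symD)
  have uv: "(u, v) \<in> E"
    using assms(1,5) by (metis symD)
  have "det ?M = ?M $ v $ v * det (cut_index v ?M) -
      ?M $ u $ v * ?M $ v $ u * det (cut_index u (cut_index v ?M))"
    by (rule det_leaf) (use assms(4) leaf leaf' in \<open>auto simp: subgraph_matrix_def\<close>)
  moreover have "?M $ v $ v = d v" "?M $ u $ v = c" "?M $ v $ u = c"
    using assms(2-5) uv by (auto simp: subgraph_matrix_def)
  ultimately show ?thesis
    by (simp add: cut_index_subgraph_matrix)
qed

lemma det_subgraph_matrix_affine:
  fixes c :: "'a::comm_ring_1" and E :: "'v::finite rel"
  assumes "u \<in> S"
  shows "\<exists>e. \<forall>x. det (subgraph_matrix E c S (d(u := x))) =
    x * det (subgraph_matrix E c (S - {u}) d) + e"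
proof -
  let ?Z = "\<lambda>x. (\<chi> i j. if i = u \<and> j = u then 0
    else subgraph_matrix E c S (d(u := x)) $ i $ j) :: 'a ^ 'v ^ 'v"
  \<comment> \<open>Only the entry at \<open>(u, u)\<close> contains \<open>x\<close>, so clearing
    it leaves a matrix independent of \<open>x\<close>.\<close>
  have Z: "?Z x = ?Z 0" for x
    by (auto simp: vec_eq_iff subgraph_matrix_def)
  have "det (subgraph_matrix E c S (d(u := x))) =
      x * det (subgraph_matrix E c (S - {u}) d) + det (?Z 0)" for x
    using det_affine_diagonal_entry[of "subgraph_matrix E c S (d(u := x))" u] assms Z[of x]
    by (simp add: cut_index_subgraph_matrix subgraph_matrix_fun_upd)
      (simp add: subgraph_matrix_def)
  then show ?thesis
    by blast
qed

section \<open>Counting\<close>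

lemma sum_PiE_insert:
  fixes g :: "('v \<Rightarrow> 'f::finite) \<Rightarrow> 'b::comm_monoid_add"
  assumes "finite S" "v \<notin> S"
  shows "(\<Sum>d\<in>insert v S \<rightarrow>\<^sub>E UNIV. g d) = (\<Sum>d\<in>S \<rightarrow>\<^sub>E UNIV. \<Sum>x\<in>UNIV. g (d(v := x)))"
proof -
  have "(\<Sum>d\<in>insert v S \<rightarrow>\<^sub>E UNIV. g d) = (\<Sum>(x, d)\<in>UNIV \<times> (S \<rightarrow>\<^sub>E UNIV). g (d(v := x)))"
    unfolding PiE_insert_eq
    by (subst sum.reindex[OF inj_combinator[OF assms(2)]]) (simp add: case_prod_unfold)
  also have "\<dots> = (\<Sum>x\<in>UNIV. \<Sum>d\<in>S \<rightarrow>\<^sub>E UNIV. g (d(v := x)))"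
    by (simp add: sum.cartesian_product)
  also have "\<dots> = (\<Sum>d\<in>S \<rightarrow>\<^sub>E UNIV. \<Sum>x\<in>UNIV. g (d(v := x)))"
    by (rule sum.swap)
  finally show ?thesis .
qed

lemma sum_of_bool_affine_eq_0:
  fixes a b :: "'f::{field,finite}"
  assumes "a \<noteq> 0"
  shows "(\<Sum>x\<in>UNIV. of_bool (x * a + b = 0)) = (1 :: 'b::ring_1)"
proof -
  have "(x * a + b = 0) = (x = - b / a)" for x
    using assms by (simp add: field_simps eq_neg_iff_add_eq_0)
  then show ?thesis
    by (simp add: of_bool_def)
qed

text \<open>Merging the cases \<open>a = 0\<close> and \<open>a \<noteq> 0\<close> into one formula
  lets it be summed term by term over the remaining diagonal.\<close>

lemma sum_of_bool_affine_neq_0: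
  fixes a b :: "'f::{field,finite}"
  shows "(\<Sum>x\<in>UNIV. of_bool (x * a - b \<noteq> 0)) =
    (of_nat CARD('f) - 1) * of_bool (a \<noteq> 0) + of_nat CARD('f) * (of_bool (a = 0 \<and> b \<noteq> 0) :: 'b::ring_1)"
proof (cases "a = 0")
  case False
  have "(\<Sum>x\<in>UNIV. of_bool (x * a - b \<noteq> 0)) = (\<Sum>x\<in>UNIV. 1 - of_bool (x * a + - b = 0) :: 'b)"
    by (intro sum.cong) auto
  also have "\<dots> = of_nat CARD('f) - 1"
    unfolding sum_subtractf sum_of_bool_affine_eq_0[OF False] by simp
  finally show ?thesis
    using False by simp
qed auto

text \<open>The functions are extensional, so each diagonal on \<open>S\<close> counts once; complex
  values allow comparison with an expression in \<open>s\<close>.\<close>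

definition invertible_count :: "'v::finite rel \<Rightarrow> 'f::{field,finite} itself \<Rightarrow> 'v set \<Rightarrow> complex" where
  "invertible_count E _ S =
    (\<Sum>d\<in>S \<rightarrow>\<^sub>E (UNIV :: 'f set). of_bool (det (subgraph_matrix E 1 S d) \<noteq> 0))"

text \<open>Deletions turn a tree into a forest, so isolated vertices do occur; there exactly the
  nonzero entries preserve invertibility.\<close>

lemma invertible_count_isolated:
  fixes E :: "'v::finite rel"
  assumes "v \<in> S" "\<And>w. w \<in> S \<Longrightarrow> (v, w) \<notin> E"
  shows "invertible_count E TYPE('f::{field,finite}) S =
    (of_nat CARD('f) - 1) * invertible_count E TYPE('f) (S - {v})"
proof -
  let ?T = "S - {v}"
  let ?a = "\<lambda>d :: 'v \<Rightarrow> 'f. det (subgraph_matrix E 1 ?T d)"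
  have S: "insert v ?T = S"
    using assms(1) by blast
  have "invertible_count E TYPE('f) S =
      (\<Sum>d\<in>?T \<rightarrow>\<^sub>E (UNIV :: 'f set). \<Sum>x\<in>UNIV. of_bool (det (subgraph_matrix E 1 S (d(v := x))) \<noteq> 0))"
    unfolding invertible_count_def by (rule sum_PiE_insert[of ?T v, unfolded S]) simp_all
  also have "\<dots> = (\<Sum>d\<in>?T \<rightarrow>\<^sub>E UNIV. \<Sum>x\<in>UNIV. of_bool (x * ?a d - 0 \<noteq> 0))"
    by (simp add: det_subgraph_matrix_isolated[OF assms] subgraph_matrix_fun_upd)
  also have "\<dots> = (of_nat CARD('f) - 1) * invertible_count E TYPE('f) ?T"
    unfolding sum_of_bool_affine_neq_0 invertible_count_def by (simp add: sum_distrib_left)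
  finally show ?thesis .
qed

lemma invertible_count_leaf:
  fixes E :: "'v::finite rel"
  assumes "sym E" "v \<in> S" "u \<in> S" "u \<noteq> v" "(v, u) \<in> E"
    and leaf: "\<And>w. w \<in> S \<Longrightarrow> (v, w) \<in> E \<Longrightarrow> w = u"
  shows "invertible_count E TYPE('f::{field,finite}) S =
    (of_nat CARD('f) - 1) * invertible_count E TYPE('f) (S - {v}) +
    of_nat CARD('f) * invertible_count E TYPE('f) (S - {v} - {u})"
proof -
  let ?T = "S - {v}" and ?U = "S - {v} - {u}"
  let ?a = "\<lambda>d :: 'v \<Rightarrow> 'f. det (subgraph_matrix E 1 ?T d)"
  let ?b = "\<lambda>d :: 'v \<Rightarrow> 'f. det (subgraph_matrix E 1 ?U d)"
  have S: "insert v ?T = S" and T: "insert u ?U = ?T"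
    using assms by blast+
  have "invertible_count E TYPE('f) S =
      (\<Sum>d\<in>?T \<rightarrow>\<^sub>E (UNIV :: 'f set). \<Sum>x\<in>UNIV. of_bool (det (subgraph_matrix E 1 S (d(v := x))) \<noteq> 0))"
    unfolding invertible_count_def by (rule sum_PiE_insert[of ?T v, unfolded S]) simp_all
  also have "\<dots> = (\<Sum>d\<in>?T \<rightarrow>\<^sub>E UNIV. \<Sum>x\<in>UNIV. of_bool (x * ?a d - ?b d \<noteq> 0))"
    by (simp add: det_subgraph_matrix_leaf[OF assms] subgraph_matrix_fun_upd)
  also have "\<dots> = (of_nat CARD('f) - 1) * invertible_count E TYPE('f) ?T +
      of_nat CARD('f) * (\<Sum>d\<in>?T \<rightarrow>\<^sub>E UNIV. of_bool (?a d = 0 \<and> ?b d \<noteq> 0))"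
    unfolding sum_of_bool_affine_neq_0 invertible_count_def
    by (simp add: sum_distrib_left sum.distrib)
  \<comment> \<open>The diagonals with vanishing \<open>?a\<close> are counted through the entry at
    \<open>u\<close>, on which \<open>?b\<close> does not depend.\<close>
  also have "(\<Sum>d\<in>?T \<rightarrow>\<^sub>E UNIV. of_bool (?a d = 0 \<and> ?b d \<noteq> 0)) =
      (\<Sum>d\<in>?U \<rightarrow>\<^sub>E UNIV. \<Sum>x\<in>UNIV. of_bool (?a (d(u := x)) = 0 \<and> ?b (d(u := x)) \<noteq> 0) :: complex)"
    by (rule sum_PiE_insert[of ?U u, unfolded T]) simp_all
  also have "\<dots> = invertible_count E TYPE('f) ?U"
    unfolding invertible_count_def
  proof (rule sum.cong[OF refl])
    fix d :: "'v \<Rightarrow> 'f"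
    obtain e where e: "\<And>x. ?a (d(u := x)) = x * ?b d + e"
      using det_subgraph_matrix_affine[of u ?T E 1 d] assms by blast
    show "(\<Sum>x\<in>UNIV. of_bool (?a (d(u := x)) = 0 \<and> ?b (d(u := x)) \<noteq> 0)) =
        (of_bool (?b d \<noteq> 0) :: complex)"
    proof (cases "?b d = 0")
      case False
      then have "(\<Sum>x\<in>UNIV. of_bool (?a (d(u := x)) = 0 \<and> ?b (d(u := x)) \<noteq> 0)) =
          (\<Sum>x\<in>UNIV. of_bool (x * ?b d + e = 0) :: complex)"
        by (intro sum.cong) (simp_all add: e subgraph_matrix_fun_upd)
      then show ?thesis
        unfolding sum_of_bool_affine_eq_0[OF False] using False by simp
    qed (simp add: subgraph_matrix_fun_upd)
  qed
  finally show ?thesis .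
qed

text \<open>Stated for all \<open>S\<close>, because deleting a leaf and its neighbour need not
  leave a tree.\<close>

lemma invertible_count_forest:
  fixes E :: "'v::finite rel" and s :: complex
  assumes "simple_graph E" "\<nexists>c. graph_cycle E c"
    and s: "s * s = - of_nat CARD('f::{field,finite})"
  shows "invertible_count E TYPE('f) S =
    (- s) ^ card S * det (subgraph_matrix E (- 1) S (\<lambda>_. s + 1 / s))"
proof (induction "card S" arbitrary: S rule: less_induct)
  case less
  have "finite S"
    by simp
  let ?q = "of_nat CARD('f) :: complex"
  define x where "x = s + 1 / s"
  let ?D = "\<lambda>S. det (subgraph_matrix E (- 1) S (\<lambda>_. x))"
  have "s \<noteq> 0"
    using s by auto
  \<comment> \<open>Deleting one vertex releases a factor \<open>- s\<close>, which turns the factor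
    \<open>x\<close> of the determinant recursion into \<open>?q - 1\<close>.\<close>
  then have q1: "- s * x = ?q - 1"
    using s by (simp add: x_def algebra_simps)
  have IH: "invertible_count E TYPE('f) T = (- s) ^ card T * ?D T" if "T \<subset> S" for T
    using less that by (simp add: psubset_card_mono x_def)
  have "invertible_count E TYPE('f) S = (- s) ^ card S * ?D S"
  proof (cases "S = {}")
    case True
    then show ?thesis
      by (simp add: invertible_count_def subgraph_matrix_empty)
  next
    case False
    then obtain v u where v: "v \<in> S" and leaf: "\<And>w. w \<in> S \<Longrightarrow> (v, w) \<in> E \<Longrightarrow> w = u"
      using acyclic_graph_leaf[OF assms(1,2) \<open>finite S\<close>] by blast
    have cv: "card S = Suc (card (S - {v}))"
      using v by (intro card.remove) auto
    have IHv: "invertible_count E TYPE('f) (S - {v}) = (- s) ^ card (S - {v}) * ?D (S - {v})"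
      using v by (intro IH) auto
    show ?thesis
    proof (cases "u \<in> S \<and> (v, u) \<in> E")
      case False
      \<comment> \<open>The vertex \<open>u\<close> may lie outside \<open>S\<close> or not be
        adjacent to \<open>v\<close>; then \<open>v\<close> has no neighbour in \<open>S\<close> at
        all.\<close>
      then have isol: "\<And>w. w \<in> S \<Longrightarrow> (v, w) \<notin> E"
        using leaf by blast
      have "invertible_count E TYPE('f) S = (?q - 1) * invertible_count E TYPE('f) (S - {v})"
        by (rule invertible_count_isolated[OF v]) (rule isol)
      moreover have "?D S = x * ?D (S - {v})"
        by (rule det_subgraph_matrix_isolated[OF v]) (rule isol)
      ultimately show ?thesis
        by (simp only: IHv cv q1[symmetric] power_Suc mult_ac)
    next
      case True
      then have u: "u \<in> S" "(v, u) \<in> E" and E: "sym E" "u \<noteq> v"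
        using assms(1) by (auto simp: simple_graph_def irrefl_def)
      have cu: "card (S - {v}) = Suc (card (S - {v} - {u}))"
        using u E by (intro card.remove) auto
      have IHu: "invertible_count E TYPE('f) (S - {v} - {u}) =
          (- s) ^ card (S - {v} - {u}) * ?D (S - {v} - {u})"
        using v by (intro IH) auto
      \<comment> \<open>Two deleted vertices release \<open>(- s) * (- s)\<close>, which turns the
        coefficient \<open>- 1\<close> into \<open>?q\<close>.\<close>
      have q: "?q = - (s * s)"
        using s by simp
      have N: "invertible_count E TYPE('f) S = (?q - 1) * invertible_count E TYPE('f) (S - {v}) +
          ?q * invertible_count E TYPE('f) (S - {v} - {u})"
        by (rule invertible_count_leaf[OF E(1) v u(1) E(2) u(2)]) (rule leaf)
      have D: "?D S = x * ?D (S - {v}) - (- 1) * (- 1) * ?D (S - {v} - {u})"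
        by (rule det_subgraph_matrix_leaf[OF E(1) v u(1) E(2) u(2)]) (rule leaf)
      show ?thesis
        unfolding N D IHv IHu q1[symmetric] unfolding q cv cu power_Suc by (simp add: algebra_simps)
    qed
  qed
  then show ?case
    by (simp add: x_def)
qed

text \<open>As there are no loops, the diagonal of an operator is its \<open>d\<close>, so operators
  and functions \<open>d\<close> correspond bijectively; on \<open>UNIV\<close> extensionality is no
  restriction.\<close>

lemma card_invertible_schroedinger:
  fixes E :: "'v::finite rel"
  assumes "irrefl E"
  shows "of_nat (card {M :: 'f::{field,finite} ^ 'v ^ 'v. schroedinger_operator E M \<and> invertible M}) =
    invertible_count E TYPE('f) UNIV"
proof -
  let ?M = "\<lambda>d :: 'v \<Rightarrow> 'f. subgraph_matrix E 1 UNIV d"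
  let ?N = "{d. det (?M d) \<noteq> 0}"
  have diag: "?M d $ i $ i = d i" for d i
    by (simp add: subgraph_matrix_def)
  have inj: "inj ?M"
    by (intro injI ext) (metis diag)
  have sum: "?M d = adjacency_matrix E + (\<chi> i j. if i = j then d i else 0)" for d
    using assms by (auto simp: vec_eq_iff subgraph_matrix_def adjacency_matrix_def irrefl_def)
  have "schroedinger_operator E M \<longleftrightarrow> M \<in> range ?M" for M
  proof
    assume "schroedinger_operator E M"
    then obtain D where D: "diagonal_matrix D" "M = adjacency_matrix E + D"
      by (auto simp: schroedinger_operator_def)
    then have "M = ?M (\<lambda>i. D $ i $ i)"
      unfolding sum by (auto simp: vec_eq_iff diagonal_matrix_def)
    then show "M \<in> range ?M"
      by blast
  next
    assume "M \<in> range ?M"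
    then show "schroedinger_operator E M"
      unfolding sum schroedinger_operator_def by (auto simp: diagonal_matrix_def)
  qed
  then have "{M. schroedinger_operator E M \<and> invertible M} = ?M ` ?N"
    by (auto simp: invertible_det_nz)
  then have "card {M :: 'f ^ 'v ^ 'v. schroedinger_operator E M \<and> invertible M} = card ?N"
    using inj by (simp add: card_image inj_on_subset)
  then show ?thesis
    by (simp add: invertible_count_def PiE_UNIV_domain)
qed

theorem theorem1:
  fixes E :: "('v::finite) rel" and q :: nat and s :: complex
  assumes "tree_graph E"
    and "q = CARD('f::{field,finite})"
    and "s = csqrt (- of_nat q)"
  shows "of_nat (card {M :: 'f ^ 'v ^ 'v. schroedinger_operator E M \<and> invertible M}) =
    (- s) ^ CARD('v) * poly (map_poly of_int (graph_charpoly E)) (s + 1 / s)"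
proof -
  have E: "simple_graph E" "irrefl E" "\<nexists>c. graph_cycle E c"
    using assms(1) by (auto simp: tree_graph_def simple_graph_def)
  have s: "s * s = - of_nat CARD('f)"
    using assms(2,3) by (metis power2_csqrt power2_eq_square)
  have "subgraph_matrix E (- 1) UNIV (\<lambda>_. s + 1 / s) =
      mat (s + 1 / s) - map_matrix of_int (adjacency_matrix E)"
    using E(2) by (auto simp: vec_eq_iff subgraph_matrix_def mat_def adjacency_matrix_def irrefl_def)
  then show ?thesis
    unfolding graph_charpoly_def poly_charpoly_of_int card_invertible_schroedinger[OF E(2)]
      invertible_count_forest[OF E(1,3) s] by simp
qed

end
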